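(* For every integer $n>2$ there exists a double-MDS-code $M\subseteq\{0,1,2,3\}^n$ that is not splittable, but such that every layer of $M$ (in every direction $i\in\{1,\dots,n\}$ and for every value $a\in\{0,1,2,3\}$) is a splittable double-MDS-code in $\{0,1,2,3\}^{n-1}$.
   Context: Let $\Sigma=\{0,1,2,3\}$. The Hamming graph $H(n,4)$ has vertex set $\Sigma^n$, two words adjacent iff they differ in exactly one coordinate. A line is a set of $4$ words agreeing in all coordinates but one. A set $S\subseteq\Sigma^n$ is a double-MDS-code if every line contains exactly two elements of $S$. A set $S$ with every line containing $0$ or $2$ of its elements is called a double-code; it is splittable if $S$ is the union of two sets each of which is independent in $H(n,4)$ (equivalently, the subgraph of $H(n,4)$ induced by $S$ is bipartite). For $i\in\{1,\dots,n\}$ and $a\in\Sigma$, the layer of $S$ of direction $i$ and value $a$ is $\{x\in S: x_i=a\}$, identified with a subset of $\Sigma^{n-1}$ by deleting the $i$th coordinate. *)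

theory Defs
  imports Main
begin

text \<open>Words of length \<open>n\<close> are lists; coordinates are numbered \<open>0, \<dots>, n - 1\<close>.\<close>

definition Sigma4 :: "nat set" where
  "Sigma4 = {0, 1, 2, 3}"

definition words :: "nat \<Rightarrow> nat list set" where
  "words n = {x. length x = n \<and> set x \<subseteq> Sigma4}"

definition hamming_adj :: "nat \<Rightarrow> nat list \<Rightarrow> nat list \<Rightarrow> bool" where
  "hamming_adj n x y \<longleftrightarrow>
     x \<in> words n \<and> y \<in> words n \<and> card {i. i < n \<and> x ! i \<noteq> y ! i} = 1"

definition is_line :: "nat \<Rightarrow> nat list set \<Rightarrow> bool" where
  "is_line n L \<longleftrightarrow> (\<exists>x\<in>words n. \<exists>i<n. L = (\<lambda>a. x[i := a]) ` Sigma4)"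

definition double_MDS_code :: "nat \<Rightarrow> nat list set \<Rightarrow> bool" where
  "double_MDS_code n S \<longleftrightarrow> S \<subseteq> words n \<and> (\<forall>L. is_line n L \<longrightarrow> card (L \<inter> S) = 2)"

definition double_code :: "nat \<Rightarrow> nat list set \<Rightarrow> bool" where
  "double_code n S \<longleftrightarrow> S \<subseteq> words n \<and> (\<forall>L. is_line n L \<longrightarrow> card (L \<inter> S) \<in> {0, 2})"

definition independent_set :: "nat \<Rightarrow> nat list set \<Rightarrow> bool" where
  "independent_set n A \<longleftrightarrow> A \<subseteq> words n \<and> (\<forall>x\<in>A. \<forall>y\<in>A. \<not> hamming_adj n x y)"

text \<open>Only used for double-codes, in particular for double-MDS-codes.\<close>

definition splittable :: "nat \<Rightarrow> nat list set \<Rightarrow> bool" where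
  "splittable n S \<longleftrightarrow> (\<exists>A B. independent_set n A \<and> independent_set n B \<and> S = A \<union> B)"

definition delete_coord :: "nat \<Rightarrow> nat list \<Rightarrow> nat list" where
  "delete_coord i x = take i x @ drop (Suc i) x"

definition layer :: "nat \<Rightarrow> nat \<Rightarrow> nat list set \<Rightarrow> nat list set" where
  "layer i a S = delete_coord i ` {x \<in> S. x ! i = a}"

lemma double_MDS_code_imp_double_code: "double_MDS_code n S \<Longrightarrow> double_code n S"
  by (simp add: double_MDS_code_def double_code_def)

end

theory Submission
  imports Defs
begin

text \<open>
  Write a letter as \<open>v = 2a + b\<close> with bits \<open>a, b\<close>.  A word \<open>x # ys\<close> is put into the code iff
  the sum of the \<open>a\<close>-bits of \<open>ys\<close> plus \<open>\<lambda>(x)\<close> is even, where \<open>\<lambda>\<close> is one of the three nonzero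
  linear functionals on \<open>x = (a, b)\<close>, chosen by the vector of \<open>b\<close>-bits of \<open>ys\<close>: one functional at the
  all-zero vector, another one at the all-one vector, the third one elsewhere.  Moving inside the
  code along a direction of \<open>ys\<close> always flips the \<open>b\<close>-bit there, and moving along the first direction
  adds the generator of \<open>ker \<lambda>\<close> to \<open>x\<close>.

  A layer either fixes \<open>x\<close>, or fixes some \<open>b\<close>-bit and hence misses one of the two exceptional vectors,
  so that only two of the three kernels occur.  Then some linear functional is nonzero on the
  occurring kernels, and adding it to the sum of the \<open>b\<close>-bits gives a proper 2-colouring.  In the whole
  code all three kernels occur, and since their generators add up to zero, there is a closed walk of
  odd length.
\<close>

section \<open>Adjacency, colourings and layers\<close>

lemma words_append_Cons:
  "u @ p # w \<in> words n \<longleftrightarrow> u @ w \<in> words (n - 1) \<and> p \<in> Sigma4 \<and> n > 0"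
  by (auto simp: words_def)

lemma Sigma4_iff: "v \<in> Sigma4 \<longleftrightarrow> v < 4"
  by (auto simp: Sigma4_def)

text \<open>The index of the differing coordinate is traded for a splitting \<open>u\<close>,
  \<open>w\<close> around it, so that the arguments about the code use append and Cons instead of
  positions.\<close>

lemma hamming_adj_iff:
  "hamming_adj n x y \<longleftrightarrow> x \<in> words n \<and> y \<in> words n \<and>
     (\<exists>u p q w. x = u @ p # w \<and> y = u @ q # w \<and> p \<noteq> q)"
proof (intro iffI conjI; (elim conjE exE)?)
  assume adj: "hamming_adj n x y"
  then show xy: "x \<in> words n" "y \<in> words n"
    by (simp_all add: hamming_adj_def)
  from adj obtain i where i: "{i. i < n \<and> x ! i \<noteq> y ! i} = {i}"
    by (auto simp: hamming_adj_def card_1_singleton_iff)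
  then have "i < n" "x ! i \<noteq> y ! i" by auto
  have len: "length x = n" "length y = n"
    using xy by (auto simp: words_def)
  have same: "x ! j = y ! j" if "j < n" "j \<noteq> i" for j
    using i that by auto
  have "take i x = take i y"
    by (rule nth_equalityI) (use len same \<open>i < n\<close> in auto)
  moreover have "drop (Suc i) x = drop (Suc i) y"
    by (rule nth_equalityI) (use len same \<open>i < n\<close> in auto)
  ultimately have "x = take i x @ x ! i # drop (Suc i) x" "y = take i x @ y ! i # drop (Suc i) x"
    using len \<open>i < n\<close> by (metis id_take_nth_drop)+
  then show "\<exists>u p q w. x = u @ p # w \<and> y = u @ q # w \<and> p \<noteq> q"
    using \<open>x ! i \<noteq> y ! i\<close> by blast
next
  fix u p q w
  assume xy: "x \<in> words n" "y \<in> words n" and eq: "x = u @ p # w" "y = u @ q # w" "p \<noteq> q"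
  have "{i. i < n \<and> x ! i \<noteq> y ! i} = {length u}"
    using xy eq by (auto simp: words_def nth_append nth_Cons')
  then show "hamming_adj n x y"
    using xy by (simp add: hamming_adj_def)
qed

lemma is_line_iff:
  "is_line n L \<longleftrightarrow> (\<exists>u w. n > 0 \<and> u @ w \<in> words (n - 1) \<and> L = (\<lambda>v. u @ v # w) ` Sigma4)"
proof
  assume "is_line n L"
  then obtain x i where x: "x \<in> words n" "i < n" and L: "L = (\<lambda>v. x[i := v]) ` Sigma4"
    by (auto simp: is_line_def)
  have "i < length x" using x by (simp add: words_def)
  then have "take i x @ x ! i # drop (Suc i) x = x"
    by (simp add: id_take_nth_drop[symmetric])
  then have "take i x @ drop (Suc i) x \<in> words (n - 1)"
    using x words_append_Cons by metis
  moreover have "L = (\<lambda>v. take i x @ v # drop (Suc i) x) ` Sigma4"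
    using \<open>i < length x\<close> L by (simp add: upd_conv_take_nth_drop)
  ultimately show "\<exists>u w. n > 0 \<and> u @ w \<in> words (n - 1) \<and> L = (\<lambda>v. u @ v # w) ` Sigma4"
    using x by auto
next
  assume "\<exists>u w. n > 0 \<and> u @ w \<in> words (n - 1) \<and> L = (\<lambda>v. u @ v # w) ` Sigma4"
  then obtain u w where "n > 0" and uw: "u @ w \<in> words (n - 1)"
    and L: "L = (\<lambda>v. u @ v # w) ` Sigma4" by blast
  have "u @ 0 # w \<in> words n"
    using uw \<open>n > 0\<close> by (simp add: words_append_Cons Sigma4_def)
  moreover from this have "length u < n" by (simp add: words_def)
  moreover have "L = (\<lambda>v. (u @ 0 # w)[length u := v]) ` Sigma4" using L by simp
  ultimately show "is_line n L"
    unfolding is_line_def by blast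
qed

lemma double_MDS_code_iff:
  "double_MDS_code n S \<longleftrightarrow> S \<subseteq> words n \<and>
     (\<forall>u w. n > 0 \<longrightarrow> u @ w \<in> words (n - 1) \<longrightarrow> card {v \<in> Sigma4. u @ v # w \<in> S} = 2)"
proof -
  have "card ((\<lambda>v. u @ v # w) ` Sigma4 \<inter> S) = card {v \<in> Sigma4. u @ v # w \<in> S}" for u w
  proof -
    have "(\<lambda>v. u @ v # w) ` Sigma4 \<inter> S = (\<lambda>v. u @ v # w) ` {v \<in> Sigma4. u @ v # w \<in> S}"
      by auto
    then show ?thesis by (simp add: card_image inj_on_def)
  qed
  then show ?thesis
    unfolding double_MDS_code_def is_line_iff by metis
qed

text \<open>Membership in \<open>A\<close> is a proper colouring even if \<open>A\<close> and
  \<open>B\<close> overlap: of two adjacent words, at most one lies in \<open>A\<close>, and if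
  neither did, both would lie in \<open>B\<close>.\<close>

lemma splittable_iff_colouring:
  assumes "S \<subseteq> words n"
  shows "splittable n S \<longleftrightarrow>
    (\<exists>c :: nat list \<Rightarrow> bool. \<forall>x\<in>S. \<forall>y\<in>S. hamming_adj n x y \<longrightarrow> c x \<noteq> c y)"
proof
  assume "splittable n S"
  then obtain A B where AB: "independent_set n A" "independent_set n B" "S = A \<union> B"
    by (auto simp: splittable_def)
  then have "\<forall>x\<in>S. \<forall>y\<in>S. hamming_adj n x y \<longrightarrow> (x \<in> A) \<noteq> (y \<in> A)"
    unfolding independent_set_def by blast
  then show "\<exists>c :: nat list \<Rightarrow> bool. \<forall>x\<in>S. \<forall>y\<in>S. hamming_adj n x y \<longrightarrow> c x \<noteq> c y"
    by (rule exI[of _ "\<lambda>x. x \<in> A"])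
next
  assume "\<exists>c :: nat list \<Rightarrow> bool. \<forall>x\<in>S. \<forall>y\<in>S. hamming_adj n x y \<longrightarrow> c x \<noteq> c y"
  then obtain c :: "nat list \<Rightarrow> bool"
    where c: "\<forall>x\<in>S. \<forall>y\<in>S. hamming_adj n x y \<longrightarrow> c x \<noteq> c y" ..
  have "independent_set n {x \<in> S. c x}" "independent_set n {x \<in> S. \<not> c x}"
    using assms c unfolding independent_set_def by blast+
  moreover have "S = {x \<in> S. c x} \<union> {x \<in> S. \<not> c x}" by blast
  ultimately show "splittable n S"
    unfolding splittable_def by (intro exI conjI)
qed

definition insert_coord :: "nat \<Rightarrow> nat \<Rightarrow> nat list \<Rightarrow> nat list" where
  "insert_coord i a z = take i z @ a # drop i z"

lemma insert_coord_delete_coord: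
  "i < length x \<Longrightarrow> insert_coord i (x ! i) (delete_coord i x) = x"
  by (simp add: insert_coord_def delete_coord_def id_take_nth_drop[symmetric] min_def)

text \<open>This turns the layer from an image under \<open>delete_coord\<close> into a preimage
  under \<open>insert_coord\<close>, so that counts and colourings can be pulled back from
  \<open>S\<close>.\<close>

lemma mem_layer_iff:
  assumes "S \<subseteq> words n" "i < n"
  shows "z \<in> layer i a S \<longleftrightarrow> length z = n - 1 \<and> insert_coord i a z \<in> S"
proof
  assume "z \<in> layer i a S"
  then obtain x where x: "x \<in> S" "x ! i = a" "z = delete_coord i x"
    by (auto simp: layer_def)
  then have "length x = n" using assms by (auto simp: words_def)
  then show "length z = n - 1 \<and> insert_coord i a z \<in> S"
    using x \<open>i < n\<close> insert_coord_delete_coord[of i x] by (auto simp: delete_coord_def)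
next
  assume z: "length z = n - 1 \<and> insert_coord i a z \<in> S"
  have "insert_coord i a z ! i = a" "delete_coord i (insert_coord i a z) = z"
    using z \<open>i < n\<close> by (auto simp: insert_coord_def delete_coord_def nth_append)
  then show "z \<in> layer i a S"
    unfolding layer_def using z by (auto intro!: image_eqI[of _ _ "insert_coord i a z"])
qed

lemma layer_subset_words:
  assumes "S \<subseteq> words n" "i < n"
  shows "layer i a S \<subseteq> words (n - 1)"
proof
  fix z assume "z \<in> layer i a S"
  then have "take i z @ a # drop i z \<in> words n"
    using assms by (auto simp: mem_layer_iff insert_coord_def)
  then show "z \<in> words (n - 1)"
    by (simp add: words_append_Cons)
qed

text \<open>Inserting a fixed letter carries lines to lines: the letter lands in \<open>u\<close> or
  in \<open>w\<close>, according to whether its position is before or after the varying coordinate.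
  The set equation keeps the alphabet under control.\<close>

lemma insert_coord_line:
  assumes "length u + length w = n" "i \<le> Suc n"
  obtains u' w' where "\<And>v. insert_coord i a (u @ v # w) = u' @ v # w'"
    and "set (u' @ w') = insert a (set (u @ w))" and "length (u' @ w') = Suc n"
proof (cases "i \<le> length u")
  case True
  show ?thesis
  proof (rule that[of "take i u @ a # drop i u" w])
    show "set ((take i u @ a # drop i u) @ w) = insert a (set (u @ w))"
      using set_append[of "take i u" "drop i u"] by auto
  qed (use True assms in \<open>auto simp: insert_coord_def\<close>)
next
  case False
  then obtain k where k: "i = length u + Suc k"
    by (metis add_Suc_right less_imp_Suc_add not_le)
  show ?thesis
  proof (rule that[of u "take k w @ a # drop k w"])
    show "set (u @ take k w @ a # drop k w) = insert a (set (u @ w))"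
      using set_append[of "take k w" "drop k w"] by auto
  qed (use k assms in \<open>auto simp: insert_coord_def\<close>)
qed

lemma double_MDS_code_layer:
  assumes S: "double_MDS_code n S" and i: "i < n" and a: "a \<in> Sigma4"
  shows "double_MDS_code (n - 1) (layer i a S)"
proof -
  have sub: "S \<subseteq> words n" using S by (simp add: double_MDS_code_def)
  have "card {v \<in> Sigma4. u @ v # w \<in> layer i a S} = 2"
    if "n - 1 > 0" and uw: "u @ w \<in> words (n - 1 - 1)" for u w
  proof -
    have len: "length u + length w = n - 2" using uw by (simp add: words_def)
    have "i \<le> Suc (n - 2)" using i by linarith
    from insert_coord_line[OF len this, of a]
    obtain u' w' where ins: "\<And>v. insert_coord i a (u @ v # w) = u' @ v # w'"
      and set': "set (u' @ w') = insert a (set (u @ w))" and len': "length (u' @ w') = Suc (n - 2)"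
      by blast
    have "u' @ w' \<in> words (n - 1)"
      using set' len' uw a that(1) by (auto simp: words_def)
    then have "card {v \<in> Sigma4. u' @ v # w' \<in> S} = 2"
      using S i by (simp add: double_MDS_code_iff)
    moreover have "u @ v # w \<in> layer i a S \<longleftrightarrow> u' @ v # w' \<in> S" for v
      using len that(1) ins by (auto simp: mem_layer_iff[OF sub i])
    ultimately show ?thesis by simp
  qed
  then show ?thesis
    using layer_subset_words[OF sub i] by (simp add: double_MDS_code_iff)
qed

lemma splittable_layer:
  fixes c :: "nat list \<Rightarrow> bool"
  assumes sub: "S \<subseteq> words n" and i: "i < n"
    and c: "\<And>x y. x \<in> S \<Longrightarrow> y \<in> S \<Longrightarrow> x ! i = a \<Longrightarrow> y ! i = a \<Longrightarrow> hamming_adj n x y \<Longrightarrow> c x \<noteq> c y"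
  shows "splittable (n - 1) (layer i a S)"
proof -
  have "c (insert_coord i a x) \<noteq> c (insert_coord i a y)"
    if x: "x \<in> layer i a S" and y: "y \<in> layer i a S" and adj: "hamming_adj (n - 1) x y" for x y
  proof -
    obtain u p q w where uw: "x = u @ p # w" "y = u @ q # w" "p \<noteq> q"
      using adj by (auto simp: hamming_adj_iff)
    have mem: "insert_coord i a x \<in> S" "insert_coord i a y \<in> S"
      and len: "length x = n - 1" "length y = n - 1"
      using x y by (simp_all add: mem_layer_iff[OF sub i])
    have "i \<le> Suc (length u + length w)" using len(1) uw(1) i by simp
    from insert_coord_line[OF refl this, of a]
    obtain u' w' where "\<And>v. insert_coord i a (u @ v # w) = u' @ v # w'"
      and "set (u' @ w') = insert a (set (u @ w))"
      and "length (u' @ w') = Suc (length u + length w)"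
      by blast
    then have "hamming_adj n (insert_coord i a x) (insert_coord i a y)"
      using mem sub uw by (auto simp: hamming_adj_iff)
    moreover have "insert_coord i a x ! i = a" "insert_coord i a y ! i = a"
      using len i by (auto simp: insert_coord_def nth_append)
    ultimately show ?thesis using c mem by blast
  qed
  then show ?thesis
    unfolding splittable_iff_colouring[OF layer_subset_words[OF sub i]]
    by (intro exI[of _ "\<lambda>z. c (insert_coord i a z)"]) blast
qed

section \<open>The code\<close>

text \<open>Values matter only modulo 2. The three branches have kernels \<open>{0, 2}\<close>,
  \<open>{0, 3}\<close> and \<open>{0, 1}\<close>; an empty \<open>ys\<close> counts as all
  even.\<close>

definition functional :: "nat list \<Rightarrow> nat \<Rightarrow> nat" where
  "functional ys x =
     (if \<forall>y\<in>set ys. even y then x mod 2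
      else if \<forall>y\<in>set ys. odd y then x div 2 + x mod 2
      else x div 2)"

definition code :: "nat \<Rightarrow> nat list set" where
  "code n = {x # ys |x ys. x # ys \<in> words n \<and>
     even (sum_list (map (\<lambda>y. y div 2) ys) + functional ys x)}"

lemma code_subset_words: "code n \<subseteq> words n"
  by (auto simp: code_def)

lemma Cons_mem_code_iff:
  "x # ys \<in> code n \<longleftrightarrow> x # ys \<in> words n \<and>
     even (sum_list (map (\<lambda>y. y div 2) ys) + functional ys x)"
  by (simp add: code_def)

text \<open>The alphabet splits into the pairs \<open>{0, p}\<close> and \<open>{q, r}\<close>, and
  \<open>P\<close> selects exactly one letter from each.\<close>

lemma card_Sigma4_filter:
  assumes "p \<in> {1, 2, 3}" "q \<in> {1, 2, 3}" "q \<noteq> p" "r \<in> {1, 2, 3}" "r \<noteq> p" "r \<noteq> q"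
    and "P 0 \<noteq> P p" "P q \<noteq> P r"
  shows "card {v \<in> Sigma4. P v} = 2"
proof -
  have "v \<in> Sigma4 \<longleftrightarrow> v = 0 \<or> v = p \<or> v = q \<or> v = r" for v
    using assms(1-6) by (auto simp: Sigma4_def)
  then have "{v \<in> Sigma4. P v} = (if P 0 then {0} else {p}) \<union> (if P q then {q} else {r})"
    using assms(7,8) by auto
  moreover have "0 \<notin> {p, q, r}" using assms by auto
  ultimately show ?thesis using assms by auto
qed

text \<open>The functional sees only the parities in the tail, whereas distinct letters of equal
  parity differ in the bit \<open>div 2\<close>. Hence the sum of these bits alone changes
  parity.\<close>

lemma same_parity_mem_code:
  assumes "x # us @ p # ws \<in> words n" "x # us @ q # ws \<in> words n"
    and "p \<noteq> q" "even p \<longleftrightarrow> even q"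
  shows "x # us @ p # ws \<in> code n \<longleftrightarrow> x # us @ q # ws \<notin> code n"
proof -
  have "functional (us @ p # ws) x = functional (us @ q # ws) x"
    using assms(4) by (simp add: functional_def)
  moreover have "even (p div 2) \<longleftrightarrow> odd (q div 2)"
  proof -
    have "p \<in> {0, 1, 2, 3}" "q \<in> {0, 1, 2, 3}"
      using assms(1,2) by (auto simp: words_def Sigma4_def)
    then show ?thesis using assms(3,4) by auto
  qed
  ultimately show ?thesis
    using assms(1,2) by (auto simp: Cons_mem_code_iff)
qed

lemma double_MDS_code_code:
  "double_MDS_code n (code n)"
  unfolding double_MDS_code_iff
proof (intro conjI allI impI code_subset_words)
  fix u w :: "nat list"
  assume n: "n > 0" and uw: "u @ w \<in> words (n - 1)"
  have words: "u @ v # w \<in> words n" if "v < 4" for v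
    using uw n that by (simp add: words_append_Cons Sigma4_iff)
  show "card {v \<in> Sigma4. u @ v # w \<in> code n} = 2"
  proof (cases u)
    case Nil
    have "v # w \<in> code n \<longleftrightarrow> even (sum_list (map (\<lambda>y. y div 2) w) + functional w v)"
      if "v < 4" for v
      using words[OF that] Nil by (simp add: Cons_mem_code_iff)
    note mem = this[of 0, simplified] this[of 1, simplified] this[of 2, simplified]
      this[of 3, simplified]
    \<comment> \<open>The functional must separate the two letters of each pair: 0, 1 and 2, 3 work
      for \<open>x mod 2\<close>, while 0, 2 and 1, 3 work for both remaining functionals, which
      therefore share a case.\<close>
    consider "\<forall>y\<in>set w. even y" | "\<not> (\<forall>y\<in>set w. even y)" by blast
    then have "card {v \<in> Sigma4. v # w \<in> code n} = 2"
    proof cases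
      case 1
      then show ?thesis
        using mem by (intro card_Sigma4_filter[of 1 2 3]) (auto simp: functional_def)
    next
      case 2
      then show ?thesis
        using mem by (intro card_Sigma4_filter[of 2 1 3]) (auto simp: functional_def)
    qed
    then show ?thesis by (simp add: Nil)
  next
    case (Cons x us)
    have "u @ p # w \<in> code n \<longleftrightarrow> u @ q # w \<notin> code n"
      if "p < 4" "q < 4" "p \<noteq> q" "even p \<longleftrightarrow> even q" for p q
      using same_parity_mem_code[of x us p w n q] words that by (simp add: Cons)
    from this[of 0 2] this[of 1 3] show ?thesis
      by (intro card_Sigma4_filter[of 2 1 3]) auto
  qed
qed

section \<open>Splittability of the layers\<close>

lemma adjacent_in_code_cases:
  assumes x: "x \<in> code n" and y: "y \<in> code n" and adj: "hamming_adj n x y"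
  obtains (first) p q zs where "x = p # zs" "y = q # zs" "p \<noteq> q" "p \<in> Sigma4" "q \<in> Sigma4"
      "even (functional zs p) \<longleftrightarrow> even (functional zs q)"
  | (other) s us p q ws where "x = s # us @ p # ws" "y = s # us @ q # ws" "even p \<longleftrightarrow> odd q"
proof -
  obtain u p q w where eq: "x = u @ p # w" "y = u @ q # w" "p \<noteq> q"
    and words: "x \<in> words n" "y \<in> words n"
    using adj by (auto simp: hamming_adj_iff)
  show ?thesis
  proof (cases u)
    case Nil
    then show ?thesis
      using eq x y words by (intro first[of p w q]) (auto simp: Cons_mem_code_iff words_def)
  next
    case (Cons s us)
    have "even p \<longleftrightarrow> odd q"
      using same_parity_mem_code[of s us p w n q] eq Cons words x y by auto
    then show ?thesis using other[of s us p w q] eq Cons by simp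
  qed
qed

text \<open>With the first letter fixed, every edge flips the parity of one tail letter, so the
  parity of the tail sum is a proper colouring.\<close>

lemma splittable_layer_code_0:
  assumes "n > 0"
  shows "splittable (n - 1) (layer 0 a (code n))"
proof (rule splittable_layer[OF code_subset_words assms])
  fix x y
  assume "x \<in> code n" "y \<in> code n" "x ! 0 = a" "y ! 0 = a" "hamming_adj n x y"
  from this(1,2,5,3,4) show "even (sum_list (tl x)) \<noteq> even (sum_list (tl y))"
    by (cases rule: adjacent_in_code_cases) auto
qed

lemma splittable_layer_code_Suc:
  assumes "Suc i < n"
  shows "splittable (n - 1) (layer (Suc i) a (code n))"
proof (rule splittable_layer[OF code_subset_words assms])
  \<comment> \<open>A tail containing \<open>a\<close> cannot have all letters of the opposite
    parity, and \<open>f\<close> is the functional reserved for that excluded case. Distinct nonzero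
    functionals have no common nonzero kernel vector, so \<open>f\<close> changes along every edge
    in the first direction.\<close>
  define f where "f x = (if even a then x div 2 + x mod 2 else x mod 2)" for x :: nat
  fix x y
  assume xy: "x \<in> code n" "y \<in> code n" and a: "x ! Suc i = a" "y ! Suc i = a"
    and adj: "hamming_adj n x y"
  from xy adj show "even (sum_list (tl x) + f (hd x)) \<noteq> even (sum_list (tl y) + f (hd y))"
  proof (cases rule: adjacent_in_code_cases)
    case (first p q zs)
    have "a \<in> set zs"
      using a first xy(1) assms by (auto simp: code_def words_def)
    then have "odd (f p + f q)"
    proof -
      have "functional zs = (\<lambda>v. v div 2) \<or>
        functional zs = (\<lambda>v. if even a then v mod 2 else v div 2 + v mod 2)"
        using \<open>a \<in> set zs\<close> by (auto simp: functional_def fun_eq_iff)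
      moreover have "p \<in> {0, 1, 2, 3}" "q \<in> {0, 1, 2, 3}"
        using first(4,5) by (simp_all add: Sigma4_def)
      ultimately show ?thesis
        using first(3,6) by (elim disjE insertE emptyE) (simp_all add: f_def split: if_splits)
    qed
    then show ?thesis using first(1,2) by auto
  next
    case (other s us p q ws)
    then show ?thesis by auto
  qed
qed

section \<open>An odd closed walk\<close>

lemma not_splittable_code:
  assumes "n > 2"
  shows "\<not> splittable n (code n)"
proof
  assume "splittable n (code n)"
  then obtain c :: "nat list \<Rightarrow> bool"
    where c: "\<And>x y. x \<in> code n \<Longrightarrow> y \<in> code n \<Longrightarrow> hamming_adj n x y \<Longrightarrow> c x \<noteq> c y"
    unfolding splittable_iff_colouring[OF code_subset_words] by blast
  have step: "c (u @ p # w) \<noteq> c (u @ q # w)"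
    if "u @ p # w \<in> code n" "u @ q # w \<in> code n" "p \<noteq> q" for u p q w
    using that code_subset_words by (intro c) (auto simp: hamming_adj_iff)
  define k where "k = n - 3"
  \<comment> \<open>The letters 0 and 1 after the first three both have \<open>div 2\<close> equal
    to 0, so they never affect the sum; raising \<open>j\<close> only makes the tail more
    odd.\<close>
  define path where "path x y z j = [x, y, z] @ replicate j 1 @ replicate (k - j) 0"
    for x y z j :: nat
  have words: "path x y z j \<in> words n" if "x < 4" "y < 4" "z < 4" "j \<le> k" for x y z j
    using that assms by (auto simp: path_def words_def Sigma4_iff k_def)
  have mem: "path x y z j \<in> code n \<longleftrightarrow> even (y div 2 + z div 2 + functional (tl (path x y z j)) x)"
    if "x < 4" "y < 4" "z < 4" "j \<le> k" for x y z j
    using words[OF that] by (simp add: path_def Cons_mem_code_iff sum_list_replicate add.assoc)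
  \<comment> \<open>Since \<open>y\<close> and \<open>z\<close> have opposite parities, the tail
    stays mixed and the functional stays \<open>x div 2\<close> for all \<open>j\<close>. The walk
    thus remains in the code and the colour changes \<open>j\<close> times.\<close>
  have walk: "c (path x y z j) = (c (path x y z 0) \<noteq> odd j)"
    if "x < 4" "y < 4" "z < 4" "odd (y + z)" "even (y div 2 + z div 2 + x div 2)" "j \<le> k" for x y z j
    using \<open>j \<le> k\<close>
  proof (induction j)
    case (Suc j)
    have "path x y z j' \<in> code n" if "j' \<le> k" for j'
    proof -
      have "functional (tl (path x y z j')) x = x div 2"
        using \<open>odd (y + z)\<close> by (auto simp: functional_def path_def)
      then show ?thesis using mem \<open>x < 4\<close> \<open>y < 4\<close> \<open>z < 4\<close> that
          \<open>even (y div 2 + z div 2 + x div 2)\<close> by simp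
    qed
    moreover have "path x y z j = ([x, y, z] @ replicate j 1) @ 0 # replicate (k - Suc j) 0"
      using Suc.prems by (simp add: path_def Suc_diff_Suc flip: replicate_Suc)
    moreover have "path x y z (Suc j) = ([x, y, z] @ replicate j 1) @ 1 # replicate (k - Suc j) 0"
      by (simp add: path_def replicate_append_same[symmetric])
    ultimately have "c (path x y z (Suc j)) \<noteq> c (path x y z j)"
      using Suc.prems step by (metis Suc_leD zero_neq_one)
    then show ?case using Suc by auto
  qed simp
  have m: "path 0 1 0 0 \<in> code n" "path 0 0 0 0 \<in> code n" "path 2 0 0 0 \<in> code n"
    "path 2 0 3 0 \<in> code n" "path 1 1 0 0 \<in> code n"
    "path 2 0 3 k \<in> code n" "path 2 1 3 k \<in> code n" "path 1 1 3 k \<in> code n" "path 1 1 0 k \<in> code n"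
    by (simp_all add: mem) (auto simp: functional_def path_def)
  have x: "c (path x y z j) \<noteq> c (path x' y z j)"
    if "path x y z j \<in> code n" "path x' y z j \<in> code n" "x \<noteq> x'" for x x' y z j
    using step[of "[]" x _ x'] that by (simp add: path_def)
  have y: "c (path x y z j) \<noteq> c (path x y' z j)"
    if "path x y z j \<in> code n" "path x y' z j \<in> code n" "y \<noteq> y'" for x y y' z j
    using step[of "[x]" y _ y'] that by (simp add: path_def)
  have z: "c (path x y z j) \<noteq> c (path x y z' j)"
    if "path x y z j \<in> code n" "path x y z' j \<in> code n" "z \<noteq> z'" for x y z z' j
    using step[of "[x, y]" z _ z'] that by (simp add: path_def)
  \<comment> \<open>The first letter runs through 0, 2, 1, 0: it changes at the all-even tail, at
    the all-odd tail and at a mixed tail, along the kernel generators 2, 3 and 1. The letter 3 in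
    third place balances \<open>x div 2 = 1\<close> on the mixed tail. There are seven single steps
    and two walks of length \<open>k\<close>, hence an odd total of
    \<open>2 * k + 7\<close>.\<close>
  have "c (path 0 1 0 0) \<noteq> c (path 0 0 0 0)" by (rule y) (use m in simp_all)
  moreover have "c (path 0 0 0 0) \<noteq> c (path 2 0 0 0)" by (rule x) (use m in simp_all)
  moreover have "c (path 2 0 0 0) \<noteq> c (path 2 0 3 0)" by (rule z) (use m in simp_all)
  moreover have "c (path 2 0 3 k) = (c (path 2 0 3 0) \<noteq> odd k)" by (rule walk) simp_all
  moreover have "c (path 2 0 3 k) \<noteq> c (path 2 1 3 k)" by (rule y) (use m in simp_all)
  moreover have "c (path 2 1 3 k) \<noteq> c (path 1 1 3 k)" by (rule x) (use m in simp_all)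
  moreover have "c (path 1 1 3 k) \<noteq> c (path 1 1 0 k)" by (rule z) (use m in simp_all)
  moreover have "c (path 1 1 0 k) = (c (path 1 1 0 0) \<noteq> odd k)" by (rule walk) simp_all
  moreover have "c (path 1 1 0 0) \<noteq> c (path 0 1 0 0)" by (rule x) (use m in simp_all)
  ultimately show False by argo
qed

theorem theorem4:
  fixes n :: nat
  assumes "n > 2"
  shows "\<exists>M. double_MDS_code n M \<and> \<not> splittable n M \<and>
           (\<forall>i<n. \<forall>a\<in>Sigma4.
              double_MDS_code (n - 1) (layer i a M) \<and> splittable (n - 1) (layer i a M))"
proof (intro exI[of _ "code n"] conjI allI ballI impI)
  show "double_MDS_code n (code n)" by (rule double_MDS_code_code)
  show "\<not> splittable n (code n)" using assms by (rule not_splittable_code)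
  fix i a
  assume i: "i < n" and "a \<in> Sigma4"
  then show "double_MDS_code (n - 1) (layer i a (code n))"
    by (intro double_MDS_code_layer double_MDS_code_code)
  show "splittable (n - 1) (layer i a (code n))"
    using i splittable_layer_code_0 splittable_layer_code_Suc by (cases i) blast+
qed

end
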